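(* Let $X$ be an infinite dimensional separable real Hilbert space with orthonormal basis $\{u^{(k)}\}_{k\in\mathbb{N}}$, let $Y$ be an infinite dimensional real Banach space, let $\widetilde A\colon X\to Y$ be an injective bounded linear operator, and let $A\colon\ell^1\to Y$ be given by $Ax=\widetilde A\bigl(\sum_{k=1}^\infty x_k u^{(k)}\bigr)$. Then the range $\mathcal{R}(A)$ is not closed in $Y$.
   Context: $\ell^1$ is the Banach space of absolutely summable real sequences $x=(x_k)_{k\in\mathbb{N}}$. $\mathcal{R}(A)$ denotes the range of $A$. *)

theory Defs
  imports "HOL-Analysis.Analysis"
begin

(* The underlying set of the Banach space l^1, with sequences indexed from 0. *)
definition ell1 :: "(nat \<Rightarrow> real) set" where
  "ell1 = {x. summable (\<lambda>k. \<bar>x k\<bar>)}"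

(* Algebraic (Hamel) dimension: no finite set spans. The type argument selects the space. *)
definition infinite_dimensional :: "'a::real_vector itself \<Rightarrow> bool" where
  "infinite_dimensional _ \<longleftrightarrow> \<not> (\<exists>B::'a set. finite B \<and> span B = UNIV)"

(* Orthonormal basis in the Hilbert space sense: the linear span is only required to be dense. *)
definition orthonormal_basis :: "(nat \<Rightarrow> 'a::real_inner) \<Rightarrow> bool" where
  "orthonormal_basis u \<longleftrightarrow>
     (\<forall>i j. u i \<bullet> u j = (if i = j then 1 else 0)) \<and> closure (span (range u)) = UNIV"

end

theory Submission
  imports Defs
begin

text \<open>
  If the range of \<open>A\<close> were closed, it would be a Banach space, and the open mapping argument would
  bound the \<open>\<ell>\<^sup>1\<close>-norm of \<open>x\<close> by a multiple of the norm of \<open>A x\<close>, hence by a multiple of its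
  \<open>\<ell>\<^sup>2\<close>-norm. The sequence of \<open>n\<close> ones followed by zeros, of norms \<open>n\<close> and \<open>sqrt n\<close>, refutes this.

  To avoid setting up \<open>\<ell>\<^sup>1\<close> as a Banach space, the open mapping argument is run inside the Hilbert
  space, with the image \<open>S\<close> of the unit ball of \<open>\<ell>\<^sup>1\<close> as an absolutely convex bounded set. The limit
  it produces lies only in the closure of \<open>S\<close>, but there every finite sum of absolute values of
  coordinates is still at most 1.
\<close>

section \<open>Open mapping argument for a closed image of a subspace\<close>

lemma convex_dyadic_sum_mem:
  fixes S :: "'a::real_vector set"
  assumes "convex S" "0 \<in> S" "\<And>k. s k \<in> S"
  shows "(\<Sum>k<n. (1/2) ^ Suc k *\<^sub>R s k) \<in> S"
  using assms(3)
proof (induction n arbitrary: s)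
  case 0
  then show ?case using assms(2) by simp
next
  case (Suc n)
  \<comment> \<open>Splitting off the first term, not the last, makes the sum the midpoint of
    \<open>s 0\<close> and a sum of the same form for the shifted sequence; hence the induction over
    arbitrary \<open>s\<close>.\<close>
  have "(\<Sum>k<Suc n. (1/2) ^ Suc k *\<^sub>R s k)
      = (1/2) *\<^sub>R s 0 + (1/2) *\<^sub>R (\<Sum>k<n. (1/2) ^ Suc k *\<^sub>R s (Suc k))"
    by (subst sum.lessThan_Suc_shift) (simp add: scaleR_sum_right)
  moreover have "(\<Sum>k<n. (1/2) ^ Suc k *\<^sub>R s (Suc k)) \<in> S"
    by (rule Suc.IH) (rule Suc.prems)
  ultimately show ?case
    using convexD[OF assms(1) Suc.prems[of 0], of _ "1/2" "1/2"] by simp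
qed

lemma zero_mem_convex_symmetric:
  fixes S :: "'a::real_vector set"
  assumes "convex S" "\<And>x. x \<in> S \<Longrightarrow> - x \<in> S" "S \<noteq> {}"
  shows "0 \<in> S"
proof -
  obtain x where "x \<in> S" using assms(3) by blast
  from convexD[OF assms(1) this assms(2)[OF this], of "1/2" "1/2"] show ?thesis by simp
qed

lemma closed_image_near_zero:
  fixes f :: "'a::real_normed_vector \<Rightarrow> 'b::banach"
  assumes f: "linear f" and L: "subspace L" and cl: "closed (f ` L)"
    and S: "convex S" "\<And>x. x \<in> S \<Longrightarrow> - x \<in> S"
    and absorb: "\<And>x. x \<in> L \<Longrightarrow> \<exists>n. x \<in> (*\<^sub>R) (real n) ` S"
  shows "\<exists>\<delta>>0. \<forall>y\<in>f ` L. norm y < \<delta> \<longrightarrow> y \<in> closure (f ` S)"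
proof -
  define R where "R = f ` L"
  have R: "subspace R"
    unfolding R_def using f L by (rule linear_subspace_image)
  define F where "F n = R \<inter> closure ((*\<^sub>R) (real n) ` f ` S)" for n
  have union: "\<Union>(range F) = R"
  proof
    show "R \<subseteq> \<Union>(range F)"
    proof
      fix y assume "y \<in> R"
      then obtain x where x: "x \<in> L" "y = f x" by (auto simp: R_def)
      obtain n s where "s \<in> S" "x = real n *\<^sub>R s" using absorb[OF x(1)] by blast
      then have "y \<in> (*\<^sub>R) (real n) ` f ` S"
        using x(2) f by (auto simp: linear_cmul)
      then show "y \<in> \<Union>(range F)"
        using \<open>y \<in> R\<close> closure_subset by (force simp: F_def)
    qed
  qed (auto simp: F_def)
  have "\<exists>n. top_of_set R interior_of F n \<noteq> {}"
  proof (rule ccontr)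
    assume none: "\<nexists>n. top_of_set R interior_of F n \<noteq> {}"
    \<comment> \<open>By Baire, countably many relatively closed sets without interior have a union
      without interior; but the union is all of \<open>R\<close>, which contains 0.\<close>
    have "top_of_set R interior_of \<Union>(range F) = {}"
    proof (rule Baire_category_alt)
      have "completely_metrizable_space (top_of_set R)"
        using cl completely_metrizable_space_closedin[OF completely_metrizable_space_euclidean]
        by (simp add: R_def)
      then show "completely_metrizable_space (top_of_set R) \<or>
          locally_compact_space (top_of_set R) \<and> regular_space (top_of_set R)" ..
      fix T assume "T \<in> range F"
      then show "closedin (top_of_set R) T \<and> top_of_set R interior_of T = {}"
        using none by (auto simp: F_def closedin_closed)
    qed simp
    moreover have "top_of_set R interior_of R = R"
      by (metis interior_of_topspace topspace_euclidean_subtopology)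
    ultimately show False
      using union subspace_0[OF R] by auto
  qed
  then obtain n y0 where "y0 \<in> top_of_set R interior_of F n" by blast
  then obtain U where "openin (top_of_set R) U" "y0 \<in> U" "U \<subseteq> F n"
    by (auto simp: interior_of_def)
  then obtain e where e: "e > 0" "ball y0 e \<inter> R \<subseteq> F n" and y0: "y0 \<in> R"
    by (meson openin_contains_ball openin_subset order_trans subsetD topspace_euclidean_subtopology
        openin_imp_subset)
  define C where "C = closure ((*\<^sub>R) (real n) ` f ` S)"
  have convC: "convex C"
    unfolding C_def using S(1) f
    by (intro convex_closure convex_scaling convex_linear_image)
  have "uminus ` (*\<^sub>R) (real n) ` f ` S \<subseteq> (*\<^sub>R) (real n) ` f ` S"
    using S(2) f by (force simp: linear_neg[symmetric] image_iff simp flip: scaleR_minus_right)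
  then have "(*\<^sub>R) (- 1) ` C \<subseteq> C"
    unfolding C_def closure_scaleR by (intro closure_mono) simp
  then have symC: "- y \<in> C" if "y \<in> C" for y
    using that by (auto simp: image_subset_iff)
  \<comment> \<open>\<open>y\<close> is the midpoint of \<open>y0 + y\<close> and
    \<open>-(y0 - y)\<close>. Both lie in \<open>C\<close>: the first by the choice of
    \<open>e\<close>, the second by symmetry as well.\<close>
  have nearC: "y \<in> C" if "y \<in> R" "norm y < e" for y
  proof -
    have "y0 + y \<in> ball y0 e \<inter> R" "y0 - y \<in> ball y0 e \<inter> R"
      using that y0 R by (auto simp: dist_norm subspace_add subspace_diff)
    then have "y0 + y \<in> C" "y0 - y \<in> C"
      using e(2) unfolding F_def C_def by blast+
    then have "y0 + y \<in> C" "- (y0 - y) \<in> C"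
      using symC by blast+
    from convexD[OF convC this, of "1/2" "1/2"]
    have "(1/2) *\<^sub>R (y0 + y) + (1/2) *\<^sub>R - (y0 - y) \<in> C" by simp
    moreover have "(1/2) *\<^sub>R (y0 + y) + (1/2) *\<^sub>R - (y0 - y) = (1/2) *\<^sub>R (y + y)"
      by (simp only: flip: scaleR_add_right) simp
    ultimately show "y \<in> C" by simp
  qed
  have "S \<noteq> {}" using absorb[OF subspace_0[OF L]] by auto
  \<comment> \<open>Dividing by \<open>Suc n\<close> is safe even for \<open>n = 0\<close>, where
    \<open>C\<close> collapses to \<open>{0}\<close>; that case is treated separately.\<close>
  define \<delta> where "\<delta> = e / Suc n"
  have "\<delta> > 0" using e by (simp add: \<delta>_def)
  moreover have "y \<in> closure (f ` S)" if "y \<in> R" "norm y < \<delta>" for y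
  proof (cases "n = 0")
    case True
    then have "C = {0}" using \<open>S \<noteq> {}\<close> by (simp add: C_def image_image image_constant_conv)
    moreover have "norm y < e" using that True by (simp add: \<delta>_def)
    ultimately have "y = 0" using nearC that by auto
    moreover have "0 \<in> S" using S \<open>S \<noteq> {}\<close> by (rule zero_mem_convex_symmetric)
    ultimately show ?thesis
      using closure_subset[of "f ` S"] linear_0[OF f] by (metis imageI subsetD)
  next
    case False
    have "norm (real n *\<^sub>R y) \<le> real (Suc n) * norm y"
      by (simp add: mult_right_mono)
    also have "\<dots> < e"
      using that(2) by (simp add: \<delta>_def field_simps)
    finally have "real n *\<^sub>R y \<in> C"
      using nearC R that(1) by (simp add: subspace_scale)
    then have "real n *\<^sub>R y \<in> (*\<^sub>R) (real n) ` closure (f ` S)"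
      by (simp add: C_def closure_scaleR)
    then show ?thesis using False by auto
  qed
  ultimately show ?thesis by (auto simp: R_def)
qed

text \<open>Successive approximation: the residual is halved at each stage by a dyadic multiple of
  an element of \<open>S\<close>, and \<open>S\<close> inside \<open>L\<close> keeps it in the
  image, so that the stage can be repeated. The corrections converge because \<open>S\<close> is
  bounded and the domain complete. Their partial sums stay in \<open>S\<close> by convexity, so the
  limit is known to lie only in \<open>closure S\<close>.\<close>

lemma closed_image_open_mapping:
  fixes f :: "'a::banach \<Rightarrow> 'b::banach"
  assumes f: "bounded_linear f" and L: "subspace L" and cl: "closed (f ` L)"
    and S: "convex S" "\<And>x. x \<in> S \<Longrightarrow> - x \<in> S" "bounded S" "S \<subseteq> L"
    and absorb: "\<And>x. x \<in> L \<Longrightarrow> \<exists>n. x \<in> (*\<^sub>R) (real n) ` S"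
  shows "\<exists>\<delta>>0. \<forall>y\<in>f ` L. norm y < \<delta> \<longrightarrow> y \<in> f ` closure S"
proof -
  interpret f: bounded_linear f by (fact f)
  have lin: "linear f" by (simp add: f.linear_axioms)
  have R: "subspace (f ` L)" using lin L by (rule linear_subspace_image)
  have "S \<noteq> {}" using absorb[OF subspace_0[OF L]] by auto
  with S(1,2) have S0: "0 \<in> S" by (rule zero_mem_convex_symmetric)
  obtain B where B: "norm x \<le> B" if "x \<in> S" for x
    using S(3) by (auto simp: bounded_iff)
  obtain \<delta> where \<delta>: "\<delta> > 0" and near: "\<And>y. y \<in> f ` L \<Longrightarrow> norm y < \<delta> \<Longrightarrow> y \<in> closure (f ` S)"
    using closed_image_near_zero[OF lin L cl S(1,2) absorb] by blast
  \<comment> \<open>Scale \<open>y\<close> up by \<open>2 ^ k\<close> into the ball of radius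
    \<delta>, approximate there with error below \<delta>/2, and scale back.\<close>
  have step: "\<exists>s\<in>S. norm (y - f ((1/2) ^ k *\<^sub>R s)) < \<delta> * (1/2) ^ Suc k"
    if y: "y \<in> f ` L" "norm y < \<delta> * (1/2) ^ k" for k y
  proof -
    have "norm (2 ^ k *\<^sub>R y) < \<delta>" using y(2) by (simp add: field_simps)
    then have "2 ^ k *\<^sub>R y \<in> closure (f ` S)"
      using near R y(1) subspace_scale by blast
    then obtain s where s: "s \<in> S" "dist (f s) (2 ^ k *\<^sub>R y) < \<delta> / 2"
      using half_gt_zero[OF \<delta>] unfolding closure_approachable by blast
    have "y - f ((1/2) ^ k *\<^sub>R s) = (1/2) ^ k *\<^sub>R (2 ^ k *\<^sub>R y - f s)"
      by (simp add: f.scaleR scaleR_diff_right power_one_over)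
    then have "norm (y - f ((1/2) ^ k *\<^sub>R s)) = (1/2) ^ k * dist (f s) (2 ^ k *\<^sub>R y)"
      by (simp add: dist_norm norm_minus_commute)
    also have "\<dots> < (1/2) ^ k * (\<delta> / 2)"
      using s(2) by (intro mult_strict_left_mono) auto
    finally show ?thesis using s(1) by (auto simp: mult_ac)
  qed
  have "y \<in> f ` closure S" if y: "y \<in> f ` L" "norm y < \<delta> / 2" for y
  proof -
    define h where
      "h k y = (SOME s. s \<in> S \<and> norm (y - f ((1/2) ^ k *\<^sub>R s)) < \<delta> * (1/2) ^ Suc k)" for k y
    have h: "h k y \<in> S \<and> norm (y - f ((1/2) ^ k *\<^sub>R h k y)) < \<delta> * (1/2) ^ Suc k"
      if "y \<in> f ` L" "norm y < \<delta> * (1/2) ^ k" for k y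
      unfolding h_def by (rule someI_ex) (use step[OF that] in blast)
    \<comment> \<open>The residual starts at \<open>2 *\<^sub>R y\<close>, whence the radius
      \<delta>/2. The corrections with weights \<open>(1/2) ^ k\<close> then add up to
      \<open>2 *\<^sub>R y\<close>, and halving them gives weights \<open>(1/2) ^ Suc k\<close> of
      total at most 1, as convexity requires.\<close>
    define r where "r = rec_nat (2 *\<^sub>R y) (\<lambda>k y. y - f ((1/2) ^ k *\<^sub>R h k y))"
    define s where "s k = h k (r k)" for k
    have r0: "r 0 = 2 *\<^sub>R y" and rS: "\<And>k. r (Suc k) = r k - f ((1/2) ^ k *\<^sub>R s k)"
      by (auto simp: r_def s_def)
    have inv: "r k \<in> f ` L \<and> norm (r k) < \<delta> * (1/2) ^ k" for k
    proof (induction k)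
      case 0
      then show ?case using y R by (simp add: r0 subspace_scale)
    next
      case (Suc k)
      then have "s k \<in> S" and *: "norm (r (Suc k)) < \<delta> * (1/2) ^ Suc k"
        using h[of "r k" k] by (auto simp: rS s_def)
      then have "(1/2) ^ k *\<^sub>R s k \<in> L" using S(4) L by (auto intro: subspace_scale)
      then show ?case using Suc R * by (auto simp: rS intro!: subspace_diff)
    qed
    then have sS: "s k \<in> S" for k using h[of "r k" k] by (auto simp: s_def)
    define z where "z k = (1/2) ^ Suc k *\<^sub>R s k" for k
    have "summable z"
    proof (rule summable_comparison_test')
      show "summable (\<lambda>k. (1/2) ^ Suc k * B)"
        by (intro summable_mult2) simp
      show "norm (z k) \<le> (1/2) ^ Suc k * B" if "k \<ge> 0" for k
        using B[OF sS[of k]] by (simp add: z_def)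
    qed
    then have sums: "(\<lambda>n. \<Sum>k<n. z k) \<longlonglongrightarrow> suminf z" by (rule summable_LIMSEQ)
    have "(\<Sum>k<n. z k) \<in> S" for n
      unfolding z_def using S(1) S0 sS by (rule convex_dyadic_sum_mem)
    with sums have "suminf z \<in> closure S"
      unfolding closure_sequential by (intro exI[of _ "\<lambda>n. \<Sum>k<n. z k"]) simp
    moreover have "f (suminf z) = y"
    proof (rule LIMSEQ_unique)
      show "(\<lambda>n. f (\<Sum>k<n. z k)) \<longlonglongrightarrow> f (suminf z)" using sums by (rule f.tendsto)
      \<comment> \<open>The recursion for \<open>r\<close> telescopes; each \<open>f (z k)\<close>
        is half of the decrement from \<open>r k\<close> to \<open>r (Suc k)\<close>.\<close>
      have partial: "f (\<Sum>k<n. z k) = y - (1/2) *\<^sub>R r n" for n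
        by (induction n) (simp_all add: r0 rS z_def f.zero f.add f.scaleR scaleR_diff_right)
      have "(\<lambda>n. \<delta> * (1/2) ^ n) \<longlonglongrightarrow> 0"
        by (intro tendsto_mult_right_zero LIMSEQ_realpow_zero) auto
      then have "r \<longlonglongrightarrow> 0"
        by (rule Lim_null_comparison[rotated]) (use inv in \<open>intro always_eventually allI less_imp_le, blast\<close>)
      then have "(\<lambda>n. y - (1/2) *\<^sub>R r n) \<longlonglongrightarrow> y - (1/2) *\<^sub>R 0"
        by (intro tendsto_intros)
      then show "(\<lambda>n. f (\<Sum>k<n. z k)) \<longlonglongrightarrow> y" by (simp add: partial)
    qed
    ultimately show ?thesis by blast
  qed
  then show ?thesis using \<delta> half_gt_zero by blast
qed

section \<open>Absolutely summable sequences\<close>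

lemma ell1_iff: "x \<in> ell1 \<longleftrightarrow> summable (\<lambda>k. \<bar>x k\<bar>)"
  by (simp add: ell1_def)

lemma ell1_add: "x \<in> ell1 \<Longrightarrow> y \<in> ell1 \<Longrightarrow> (\<lambda>k. x k + y k) \<in> ell1"
  unfolding ell1_iff
  by (rule summable_comparison_test'[OF summable_add[of "\<lambda>k. \<bar>x k\<bar>" "\<lambda>k. \<bar>y k\<bar>"]]) auto

lemma ell1_cmult: "x \<in> ell1 \<Longrightarrow> (\<lambda>k. c * x k) \<in> ell1"
  by (simp add: ell1_iff abs_mult summable_mult)

lemma suminf_abs_add_le:
  assumes "x \<in> ell1" "y \<in> ell1"
  shows "(\<Sum>k. \<bar>x k + y k\<bar>) \<le> (\<Sum>k. \<bar>x k\<bar>) + (\<Sum>k. \<bar>y k\<bar>)"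
proof -
  have sum: "summable (\<lambda>k. \<bar>x k\<bar>)" "summable (\<lambda>k. \<bar>y k\<bar>)" "summable (\<lambda>k. \<bar>x k + y k\<bar>)"
    using assms ell1_add[OF assms] by (simp_all only: ell1_iff)
  have "(\<Sum>k. \<bar>x k + y k\<bar>) \<le> (\<Sum>k. \<bar>x k\<bar> + \<bar>y k\<bar>)"
    by (rule suminf_le[OF abs_triangle_ineq sum(3) summable_add[OF sum(1,2)]])
  then show ?thesis by (simp only: suminf_add[OF sum(1,2)])
qed

section \<open>The images of \<ell>1 and of its unit ball in the Hilbert space\<close>

context
  fixes u :: "nat \<Rightarrow> 'x::{real_inner, banach}"
  assumes orthonormal: "\<And>i j. u i \<bullet> u j = (if i = j then 1 else 0)"
begin

lemma norm_orthonormal: "norm (u k) = 1"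
  using orthonormal[of k k] by (simp add: norm_eq_1)

lemma summable_ell1_expansion:
  assumes "x \<in> ell1"
  shows "summable (\<lambda>k. norm (x k *\<^sub>R u k))" "summable (\<lambda>k. x k *\<^sub>R u k)"
proof -
  show "summable (\<lambda>k. norm (x k *\<^sub>R u k))"
    using assms by (simp add: ell1_iff norm_orthonormal)
  then show "summable (\<lambda>k. x k *\<^sub>R u k)" by (rule summable_norm_cancel)
qed

text \<open>The inner product is continuous, so it passes through the series, and orthonormality
  leaves a single term.\<close>

lemma inner_ell1_expansion:
  assumes "x \<in> ell1"
  shows "(\<Sum>k. x k *\<^sub>R u k) \<bullet> u i = x i"
proof -
  have "(\<Sum>k. x k *\<^sub>R u k) \<bullet> u i = (\<Sum>k. (x k *\<^sub>R u k) \<bullet> u i)"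
    using bounded_linear.suminf[OF bounded_linear_inner_left summable_ell1_expansion(2)[OF assms]]
    by simp
  also have "\<dots> = (\<Sum>k\<in>{i}. (x k *\<^sub>R u k) \<bullet> u i)"
    by (rule suminf_finite) (auto simp: orthonormal)
  finally show ?thesis by (simp add: orthonormal)
qed

lemma norm_sum_orthonormal: "norm (\<Sum>k<n. u k) = sqrt n"
proof -
  have "(\<Sum>k<n. u k) \<bullet> (\<Sum>k<n. u k) = (\<Sum>i<n. \<Sum>j<n. if i = j then 1 else 0)"
    by (simp add: inner_sum_left inner_sum_right orthonormal)
  also have "\<dots> = real n" by simp
  finally show ?thesis by (simp add: norm_eq_sqrt_inner)
qed

definition ell1_image :: "'x set" where
  "ell1_image = (\<lambda>x. \<Sum>k. x k *\<^sub>R u k) ` ell1"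

definition ell1_ball_image :: "'x set" where
  "ell1_ball_image = (\<lambda>x. \<Sum>k. x k *\<^sub>R u k) ` {x \<in> ell1. (\<Sum>k. \<bar>x k\<bar>) \<le> 1}"

lemma expansion_add:
  assumes "x \<in> ell1" "y \<in> ell1"
  shows "(\<Sum>k. (x k + y k) *\<^sub>R u k) = (\<Sum>k. x k *\<^sub>R u k) + (\<Sum>k. y k *\<^sub>R u k)"
  using suminf_add[OF assms[THEN summable_ell1_expansion(2)]] by (simp add: scaleR_add_left)

lemma expansion_cmult:
  assumes "x \<in> ell1"
  shows "(\<Sum>k. (c * x k) *\<^sub>R u k) = c *\<^sub>R (\<Sum>k. x k *\<^sub>R u k)"
  using suminf_scaleR_right[OF summable_ell1_expansion(2)[OF assms], of c] by simp

lemma subspace_ell1_image: "subspace ell1_image"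
proof (rule subspaceI)
  have "(\<lambda>k. 0) \<in> ell1" by (simp add: ell1_iff)
  then show "0 \<in> ell1_image" unfolding ell1_image_def by force
  show "a + b \<in> ell1_image" if "a \<in> ell1_image" "b \<in> ell1_image" for a b
    using that unfolding ell1_image_def by (auto simp flip: expansion_add intro!: ell1_add)
  show "c *\<^sub>R a \<in> ell1_image" if "a \<in> ell1_image" for c a
    using that unfolding ell1_image_def by (auto simp flip: expansion_cmult intro!: ell1_cmult)
qed

text \<open>Common source of symmetry, with \<open>c = -1\<close>, and of absorption, with
  \<open>c\<close> the inverse of a bound on the norm of \<open>x\<close>.\<close>

lemma ell1_ball_image_cmult:
  assumes x: "x \<in> ell1" and c: "\<bar>c\<bar> * (\<Sum>k. \<bar>x k\<bar>) \<le> 1"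
  shows "c *\<^sub>R (\<Sum>k. x k *\<^sub>R u k) \<in> ell1_ball_image"
proof -
  have "(\<Sum>k. \<bar>c * x k\<bar>) = \<bar>c\<bar> * (\<Sum>k. \<bar>x k\<bar>)"
    using x by (simp add: abs_mult ell1_iff suminf_mult)
  then show ?thesis
    unfolding ell1_ball_image_def using x c
    by (intro image_eqI[of _ _ "\<lambda>k. c * x k"]) (simp_all add: expansion_cmult ell1_cmult)
qed

lemma convex_ell1_ball_image: "convex ell1_ball_image"
proof (rule convexI)
  fix a b and s t :: real
  assume "a \<in> ell1_ball_image" "b \<in> ell1_ball_image" and st: "0 \<le> s" "0 \<le> t" "s + t = 1"
  then obtain x y where xy: "x \<in> ell1" "y \<in> ell1" "(\<Sum>k. \<bar>x k\<bar>) \<le> 1" "(\<Sum>k. \<bar>y k\<bar>) \<le> 1"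
    and ab: "a = (\<Sum>k. x k *\<^sub>R u k)" "b = (\<Sum>k. y k *\<^sub>R u k)"
    unfolding ell1_ball_image_def by auto
  let ?z = "\<lambda>k. s * x k + t * y k"
  have "(\<Sum>k. \<bar>?z k\<bar>) \<le> (\<Sum>k. \<bar>s * x k\<bar>) + (\<Sum>k. \<bar>t * y k\<bar>)"
    using xy by (intro suminf_abs_add_le ell1_cmult)
  also have "\<dots> = s * (\<Sum>k. \<bar>x k\<bar>) + t * (\<Sum>k. \<bar>y k\<bar>)"
    using xy st by (simp add: abs_mult ell1_iff suminf_mult)
  also have "\<dots> \<le> 1"
    using convex_bound_le[OF xy(3,4) st] by simp
  finally have "(\<Sum>k. \<bar>?z k\<bar>) \<le> 1" .
  moreover have "?z \<in> ell1" using xy by (intro ell1_add ell1_cmult)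
  moreover have "s *\<^sub>R a + t *\<^sub>R b = (\<Sum>k. ?z k *\<^sub>R u k)"
    using xy by (simp only: ab expansion_add expansion_cmult ell1_cmult)
  ultimately show "s *\<^sub>R a + t *\<^sub>R b \<in> ell1_ball_image"
    unfolding ell1_ball_image_def by (intro image_eqI[of _ _ ?z]) auto
qed

lemma uminus_ell1_ball_image: "a \<in> ell1_ball_image \<Longrightarrow> - a \<in> ell1_ball_image"
  using ell1_ball_image_cmult[of _ "-1"] by (auto simp: ell1_ball_image_def)

lemma bounded_ell1_ball_image: "bounded ell1_ball_image"
  unfolding bounded_iff
proof (intro exI ballI)
  fix a assume "a \<in> ell1_ball_image"
  then obtain x where x: "x \<in> ell1" "(\<Sum>k. \<bar>x k\<bar>) \<le> 1" and a: "a = (\<Sum>k. x k *\<^sub>R u k)"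
    unfolding ell1_ball_image_def by auto
  have "norm a \<le> (\<Sum>k. norm (x k *\<^sub>R u k))"
    unfolding a using x(1) by (intro summable_norm summable_ell1_expansion)
  then show "norm a \<le> 1" using x(2) by (simp add: norm_orthonormal)
qed

lemma ell1_ball_image_absorbing:
  assumes "a \<in> ell1_image"
  shows "\<exists>n. a \<in> (*\<^sub>R) (real n) ` ell1_ball_image"
proof -
  obtain x where x: "x \<in> ell1" and a: "a = (\<Sum>k. x k *\<^sub>R u k)"
    using assms unfolding ell1_image_def by auto
  obtain n where n: "(\<Sum>k. \<bar>x k\<bar>) \<le> real n" using real_arch_simple by blast
  \<comment> \<open>Passing to \<open>Suc n\<close> makes the scaling factor invertible.\<close>
  have "(\<Sum>k. \<bar>x k\<bar>) \<le> real (Suc n)" using n by simp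
  then have "inverse (real (Suc n)) *\<^sub>R a \<in> ell1_ball_image"
    unfolding a using x by (intro ell1_ball_image_cmult) (simp_all add: field_simps)
  moreover have "a = real (Suc n) *\<^sub>R inverse (real (Suc n)) *\<^sub>R a"
    by (simp del: of_nat_Suc)
  ultimately show ?thesis by blast
qed

text \<open>A sum over finitely many coordinates is continuous in \<open>a\<close>, so the bound
  cuts out a closed set; on the ball image it follows from the bound on the full series.\<close>

lemma closure_ell1_ball_image_coords:
  assumes "a \<in> closure ell1_ball_image"
  shows "(\<Sum>k<n. \<bar>a \<bullet> u k\<bar>) \<le> 1"
proof -
  have "ell1_ball_image \<subseteq> {a. (\<Sum>k<n. \<bar>a \<bullet> u k\<bar>) \<le> 1}"
  proof clarify
    fix a assume "a \<in> ell1_ball_image"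
    then obtain x where x: "x \<in> ell1" "(\<Sum>k. \<bar>x k\<bar>) \<le> 1" and a: "a = (\<Sum>k. x k *\<^sub>R u k)"
      unfolding ell1_ball_image_def by auto
    have "(\<Sum>k<n. \<bar>x k\<bar>) \<le> (\<Sum>k. \<bar>x k\<bar>)"
      using x(1) by (intro sum_le_suminf) (auto simp: ell1_iff)
    then show "(\<Sum>k<n. \<bar>a \<bullet> u k\<bar>) \<le> 1"
      using x by (simp add: a inner_ell1_expansion)
  qed
  moreover have "closed {a. (\<Sum>k<n. \<bar>a \<bullet> u k\<bar>) \<le> 1}"
    by (intro closed_Collect_le continuous_intros)
  ultimately show ?thesis using assms closure_minimal by blast
qed

section \<open>Vectors with \<open>n\<close> equal coordinates and the contradiction\<close>

lemma sum_orthonormal_in_ell1_image: "(\<Sum>k<n. u k) \<in> ell1_image"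
proof -
  let ?x = "\<lambda>k. if k < n then 1 else 0 :: real"
  have "summable (\<lambda>k. \<bar>?x k\<bar>)"
    by (rule summable_finite[of "{..<n}"]) auto
  then have "?x \<in> ell1" by (simp add: ell1_iff)
  moreover have "(\<Sum>k. ?x k *\<^sub>R u k) = (\<Sum>k<n. u k)"
    by (subst suminf_finite[of "{..<n}"]) auto
  ultimately show ?thesis
    unfolding ell1_image_def by (intro image_eqI[of _ _ ?x]) simp_all
qed

lemma not_closed_ell1_image:
  fixes f :: "'x \<Rightarrow> 'y::banach"
  assumes f: "bounded_linear f" and inj: "inj f"
  shows "\<not> closed (f ` ell1_image)"
proof
  assume cl: "closed (f ` ell1_image)"
  interpret f: bounded_linear f by (fact f)
  have sub: "ell1_ball_image \<subseteq> ell1_image"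
    by (auto simp: ell1_ball_image_def ell1_image_def)
  obtain \<delta> where \<delta>: "\<delta> > 0"
    and open_map: "\<And>y. y \<in> f ` ell1_image \<Longrightarrow> norm y < \<delta> \<Longrightarrow> y \<in> f ` closure ell1_ball_image"
    using closed_image_open_mapping[OF f subspace_ell1_image cl convex_ell1_ball_image
        uminus_ell1_ball_image bounded_ell1_ball_image sub ell1_ball_image_absorbing] by blast
  obtain K where K: "K > 0" "\<And>x. norm (f x) \<le> norm x * K"
    using f.pos_bounded by blast
  obtain n :: nat where n: "(2 * K / \<delta>)\<^sup>2 < real n" using reals_Archimedean2 by blast
  \<comment> \<open>The choice of \<open>n\<close> is the exact negation of
    \<open>sqrt n \<le> 2 * K / \<delta>\<close>, which the coordinate bound for \<open>w\<close>
    will yield.\<close>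
  then have "0 < real n" by (rule le_less_trans[OF zero_le_power2])
  have sq: "2 * K / \<delta> < sqrt n" using n by (rule real_less_rsqrt)
  \<comment> \<open>Since the sum of \<open>n\<close> orthonormal vectors has norm
    \<open>sqrt n\<close>, this gives \<open>w\<close> the norm \<open>\<delta> / (2 * K)\<close>,
    so that \<open>norm (f w) \<le> \<delta> / 2\<close>.\<close>
  define t where "t = \<delta> / (2 * K * sqrt n)"
  define w where "w = t *\<^sub>R (\<Sum>k<n. u k)"
  have "t > 0" using \<delta> K \<open>0 < real n\<close> by (simp add: t_def)
  have "w \<in> ell1_image"
    unfolding w_def by (intro subspace_scale subspace_ell1_image sum_orthonormal_in_ell1_image)
  moreover have "norm (f w) < \<delta>"
  proof -
    have "norm (f w) \<le> norm w * K" by (rule K(2))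
    also have "norm w * K = \<delta> / 2"
      using \<delta> \<open>t > 0\<close> K(1) \<open>0 < real n\<close> by (simp add: w_def norm_sum_orthonormal t_def)
    finally show ?thesis using \<delta> by simp
  qed
  \<comment> \<open>The preimage supplied by the open mapping argument may lie outside
    \<open>ell1_image\<close>; injectivity of \<open>f\<close> on the whole space identifies it with
    \<open>w\<close>.\<close>
  ultimately have "w \<in> closure ell1_ball_image"
    using open_map[OF imageI] inj_image_mem_iff[OF inj] by blast
  then have "(\<Sum>k<n. \<bar>w \<bullet> u k\<bar>) \<le> 1" by (rule closure_ell1_ball_image_coords)
  moreover have "w \<bullet> u k = t" if "k < n" for k
    using that by (simp add: w_def inner_sum_left orthonormal)
  ultimately have le: "real n * t \<le> 1" using \<open>t > 0\<close> by simp
  have "real n * t = (real n / sqrt n) * (\<delta> / (2 * K))"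
    by (simp add: t_def)
  then have "sqrt n * (\<delta> / (2 * K)) \<le> 1"
    using le by (simp add: real_div_sqrt)
  then have "sqrt n \<le> 2 * K / \<delta>" using \<delta> K(1) by (simp add: field_simps)
  with sq show False by simp
qed

end

theorem proposition1p1:
  fixes u :: "nat \<Rightarrow> 'x::{real_inner, banach}"
    and At :: "'x \<Rightarrow> 'y::banach"
    and A :: "(nat \<Rightarrow> real) \<Rightarrow> 'y"
  assumes "infinite_dimensional TYPE('x)"
    and "separable_space (euclidean :: 'x topology)"
    and "orthonormal_basis u"
    and "infinite_dimensional TYPE('y)"
    and "bounded_linear At"
    and "inj At"
    and "\<And>x. x \<in> ell1 \<Longrightarrow> A x = At (\<Sum>k. x k *\<^sub>R u k)"
  shows "\<not> closed (A ` ell1)"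
proof -
  have orth: "\<And>i j. u i \<bullet> u j = (if i = j then 1 else 0)"
    using assms(3) by (simp add: orthonormal_basis_def)
  have "A ` ell1 = At ` ell1_image u"
    using assms(7) by (simp add: ell1_image_def[OF orth] image_image)
  then show ?thesis
    using not_closed_ell1_image[OF orth assms(5,6)] by simp
qed

end
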